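(* Let $G$ be a finite non-abelian nilpotent group with the strong EKR property. Then $G$ is the direct product of a $2$-group and an abelian group of odd order.
   Context: Let a finite group $G$ act transitively on a finite set $X$. A subset $S\subseteq G$ is called intersecting (for this action) if for all $g,h\in S$ there exists $x\in X$ with $g\cdot x=h\cdot x$. The action has the weak EKR property if every intersecting set $S\subseteq G$ satisfies $|S|\le |G|/|X|$ (the cardinality of a point stabilizer). The action has the strong EKR property if it has the weak EKR property and, in addition, the only intersecting sets of size $|G|/|X|$ are the cosets of point stabilizers. A finite group $G$ has the strong EKR property if every transitive action of $G$ on a finite set has the strong EKR property; equivalently, for every subgroup $H\le G$ the action of $G$ on $G/H$ by left translation, $g\cdot(xH)=(gx)H$, has the strong EKR property (here the point stabilizers are the conjugates of $H$). *)

theory Defs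
  imports Complex_Main "HOL-Algebra.Group_Action" "HOL-Algebra.Left_Coset"
    "HOL-Algebra.Generated_Groups"
begin

definition intersecting ::
  "('a, 'm) monoid_scheme \<Rightarrow> 'b set \<Rightarrow> ('a \<Rightarrow> 'b \<Rightarrow> 'b) \<Rightarrow> 'a set \<Rightarrow> bool"
  where "intersecting G X \<phi> S \<longleftrightarrow>
    S \<subseteq> carrier G \<and> (\<forall>g\<in>S. \<forall>h\<in>S. \<exists>x\<in>X. \<phi> g x = \<phi> h x)"

definition weak_EKR_action ::
  "('a, 'm) monoid_scheme \<Rightarrow> 'b set \<Rightarrow> ('a \<Rightarrow> 'b \<Rightarrow> 'b) \<Rightarrow> bool"
  where "weak_EKR_action G X \<phi> \<longleftrightarrow>
    (\<forall>S. intersecting G X \<phi> S \<longrightarrow> real (card S) \<le> real (order G) / real (card X))"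

text \<open>
  Left cosets suffice below: a right coset of a point stabilizer is a left coset of a conjugate
  subgroup, which is again a point stabilizer.
\<close>

definition strong_EKR_action ::
  "('a, 'm) monoid_scheme \<Rightarrow> 'b set \<Rightarrow> ('a \<Rightarrow> 'b \<Rightarrow> 'b) \<Rightarrow> bool"
  where "strong_EKR_action G X \<phi> \<longleftrightarrow>
    weak_EKR_action G X \<phi> \<and>
    (\<forall>S. intersecting G X \<phi> S \<and> real (card S) = real (order G) / real (card X) \<longrightarrow>
         (\<exists>x\<in>X. S \<in> lcosets\<^bsub>G\<^esub> (stabilizer G \<phi> x)))"

text \<open>
  A definition cannot quantify over types, so the finite sets acted upon are taken to be sets of
  natural numbers; \<open>strong_EKR_groupD\<close> below shows that this covers finite sets of every type.
  The locale \<open>transitive_action\<close> admits the empty set, on which the strong property fails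
  (\<open>{}\<close> is intersecting, but there is no point stabilizer); hence the condition \<open>X \<noteq> {}\<close>.
\<close>

definition strong_EKR_group :: "('a, 'm) monoid_scheme \<Rightarrow> bool"
  where "strong_EKR_group G \<longleftrightarrow>
    (\<forall>(X :: nat set) \<phi>. finite X \<and> X \<noteq> {} \<and> transitive_action G X \<phi> \<longrightarrow>
       strong_EKR_action G X \<phi>)"

definition commutator_subgroup :: "('a, 'm) monoid_scheme \<Rightarrow> 'a set \<Rightarrow> 'a set \<Rightarrow> 'a set"
  where "commutator_subgroup G H K =
    generate G (\<Union>h\<in>H. \<Union>k\<in>K. {h \<otimes>\<^bsub>G\<^esub> k \<otimes>\<^bsub>G\<^esub> (inv\<^bsub>G\<^esub> h) \<otimes>\<^bsub>G\<^esub> (inv\<^bsub>G\<^esub> k)})"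

primrec lower_central_series :: "('a, 'm) monoid_scheme \<Rightarrow> nat \<Rightarrow> 'a set"
  where
    "lower_central_series G 0 = carrier G"
  | "lower_central_series G (Suc n) =
       commutator_subgroup G (lower_central_series G n) (carrier G)"

definition nilpotent_group :: "('a, 'm) monoid_scheme \<Rightarrow> bool"
  where "nilpotent_group G \<longleftrightarrow> group G \<and> (\<exists>n. lower_central_series G n = {\<one>\<^bsub>G\<^esub>})"

lemma strong_EKR_groupD:
  fixes X :: "'b set" and \<phi> :: "'a \<Rightarrow> 'b \<Rightarrow> 'b"
  assumes EKR: "strong_EKR_group G" and fin: "finite X" and ne: "X \<noteq> {}"
    and act: "transitive_action G X \<phi>"
  shows "strong_EKR_action G X \<phi>"
proof -
  interpret transitive_action G X \<phi> by (rule act)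
  interpret gh: group_hom G "BijGroup X" \<phi> by (rule group_hom)
  obtain f :: "'b \<Rightarrow> nat" where inj: "inj_on f X"
    using fin finite_imp_inj_to_nat_seg by blast
  define Y where "Y = f ` X"
  define r where "r = inv_into X f"
  define \<psi> where "\<psi> = (\<lambda>g. \<lambda>y\<in>Y. f (\<phi> g (r y)))"
  have rf: "r (f x) = x" if "x \<in> X" for x
    using that inj by (simp add: r_def)
  have cl: "\<phi> g x \<in> X" if "g \<in> carrier G" "x \<in> X" for g x
    using that element_image by blast
  have \<psi>f: "\<psi> g (f x) = f (\<phi> g x)" if "x \<in> X" for g x
    using that by (simp add: \<psi>_def Y_def rf)
  have feq: "f a = f b \<longleftrightarrow> a = b" if "a \<in> X" "b \<in> X" for a b
    using that inj by (auto dest: inj_onD)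
  have bij: "\<psi> g \<in> Bij Y" if g: "g \<in> carrier G" for g
  proof -
    have "inj_on (\<psi> g) Y"
    proof (rule inj_onI)
      fix y y' assume "y \<in> Y" "y' \<in> Y" and e: "\<psi> g y = \<psi> g y'"
      then obtain x x' where x: "x \<in> X" "y = f x" "x' \<in> X" "y' = f x'"
        by (auto simp: Y_def)
      with e have "\<phi> g x = \<phi> g x'"
        using cl g by (simp add: \<psi>f feq)
      then show "y = y'"
        using x inj_prop[OF g] by (auto dest: inj_onD)
    qed
    moreover have "\<psi> g ` Y = Y"
    proof -
      have "\<psi> g ` Y = f ` (\<phi> g ` X)"
        by (simp add: Y_def image_image \<psi>f)
      then show ?thesis
        using surj_prop[OF g] by (simp add: Y_def)
    qed
    ultimately show ?thesis
      by (simp add: Bij_def bij_betw_def \<psi>_def)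
  qed
  have mult: "\<psi> (g \<otimes>\<^bsub>G\<^esub> h) = compose Y (\<psi> g) (\<psi> h)"
    if g: "g \<in> carrier G" and h: "h \<in> carrier G" for g h
  proof
    fix y
    show "\<psi> (g \<otimes>\<^bsub>G\<^esub> h) y = compose Y (\<psi> g) (\<psi> h) y"
    proof (cases "y \<in> Y")
      case True
      then obtain x where x: "x \<in> X" "y = f x"
        by (auto simp: Y_def)
      then show ?thesis
        using True cl g h by (simp add: compose_eq \<psi>f composition_rule del: gh.hom_mult)
    next
      case False
      then show ?thesis
        by (simp add: \<psi>_def compose_def)
    qed
  qed
  have "\<psi> \<in> hom G (BijGroup Y)"
    by (rule homI) (simp_all add: BijGroup_def bij mult)
  then have "group_hom G (BijGroup Y) \<psi>"
    by (intro group_hom.intro group_hom_axioms.intro group_BijGroup) (rule gh.G.is_group)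
  then have "transitive_action G Y \<psi>"
  proof (intro transitive_action.intro transitive_action_axioms.intro group_action.intro)
    fix y y' assume "y \<in> Y" "y' \<in> Y"
    then obtain x x' where x: "x \<in> X" "y = f x" "x' \<in> X" "y' = f x'"
      by (auto simp: Y_def)
    then obtain g where "g \<in> carrier G" "\<phi> g x = x'"
      using unique_orbit by blast
    then show "\<exists>g\<in>carrier G. \<psi> g y = y'"
      using x by (auto simp: \<psi>f)
  qed
  then have "strong_EKR_action G Y \<psi>"
    using EKR fin ne by (simp add: strong_EKR_group_def Y_def)
  moreover have "intersecting G Y \<psi> S \<longleftrightarrow> intersecting G X \<phi> S" for S
    unfolding intersecting_def Y_def by (auto simp: \<psi>f feq cl subset_iff)
  moreover have "card Y = card X"
    using inj by (simp add: Y_def card_image)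
  moreover have "stabilizer G \<psi> (f x) = stabilizer G \<phi> x" if "x \<in> X" for x
    using that cl by (auto simp: stabilizer_def \<psi>f feq)
  ultimately show ?thesis
    unfolding strong_EKR_action_def weak_EKR_action_def by (auto simp: Y_def)
qed

end

theory Submission
  imports Defs "HOL-Algebra.Multiplicative_Group" "HOL-Algebra.Sylow" "HOL-Number_Theory.Cong"
begin

text \<open>
  It suffices to show that every element of odd prime power order is central. If not, choose a
  normal subgroup \<open>N\<close> maximal such that \<open>Q = G/N\<close> still has a non-central \<open>p\<close>-element. Since \<open>Q\<close> has
  a non-trivial center and \<open>p\<close>-elements become central in every proper quotient of \<open>Q\<close>, the
  commutator of a \<open>p\<close>-element with any element lies in every non-trivial central subgroup, so it is
  central with \<open>p\<close>-th power \<open>1\<close>. As \<open>p\<close> is odd, this yields a non-central \<open>x \<in> Q\<close> of order \<open>p\<close>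
  and \<open>g\<close> with \<open>xg = zgx\<close>, where \<open>z \<noteq> 1\<close> is central. Then every \<open>x\<^sup>j z\<close> with \<open>p\<close> not dividing
  \<open>j\<close> is conjugate to \<open>x\<^sup>j\<close>. Hence replacing \<open>x\<^sup>2\<close> by \<open>x\<^sup>2 z\<close> in \<open>\<langle>x\<rangle>\<close> gives an intersecting set
  for the action on the cosets of \<open>\<langle>x\<rangle>\<close> which has the maximal size \<open>p\<close> but is not a subgroup, so
  it is not a coset of a point stabilizer. The preimage in \<open>G\<close> contradicts the strong EKR property.
\<close>

section \<open>Intersecting sets for coset actions\<close>

text \<open>
  An intersecting set of maximal size that contains \<open>1\<close> must be a point stabilizer; retaining only
  that it is a subgroup gives a property that passes to quotients.
\<close>


definition sub_EKR :: "('a, 'm) monoid_scheme \<Rightarrow> bool"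
  where "sub_EKR G \<longleftrightarrow>
    (\<forall>H S. subgroup H G \<and> S \<subseteq> carrier G \<and> card S = card H \<and> \<one>\<^bsub>G\<^esub> \<in> S \<and>
      (\<forall>s\<in>S. \<forall>t\<in>S. \<exists>u\<in>carrier G. inv\<^bsub>G\<^esub> u \<otimes>\<^bsub>G\<^esub> (inv\<^bsub>G\<^esub> s \<otimes>\<^bsub>G\<^esub> t) \<otimes>\<^bsub>G\<^esub> u \<in> H) \<longrightarrow>
      subgroup S G)"

text \<open>The restriction to \<open>lcosets\<close> makes each value an extensional map, as
  membership in \<open>Bij\<close> demands.\<close>

definition coset_action :: "('a, 'm) monoid_scheme \<Rightarrow> 'a set \<Rightarrow> 'a \<Rightarrow> 'a set \<Rightarrow> 'a set"
  where "coset_action G H g = (\<lambda>C \<in> lcosets\<^bsub>G\<^esub> H. g <#\<^bsub>G\<^esub> C)"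

context group
begin

lemma lcosetsE:
  assumes "C \<in> lcosets H"
  obtains a where "a \<in> carrier G" "C = a <# H"
  using assms by (auto simp: LCOSETS_def)

lemma lcosetsI: "a \<in> carrier G \<Longrightarrow> a <# H \<in> lcosets H"
  by (auto simp: LCOSETS_def)

lemma l_coset_lcosets:
  assumes "subgroup H G" "g \<in> carrier G" "C \<in> lcosets H"
  shows "g <# C \<in> lcosets H"
  using assms by (metis lcosetsE lcosetsI lcos_m_assoc m_closed subgroup.subset)

lemma lcosets_subset_carrier: "subgroup H G \<Longrightarrow> C \<in> lcosets H \<Longrightarrow> C \<subseteq> carrier G"
  using lcosets_subset_PowG by blast

lemma transitive_coset_action:
  assumes H: "subgroup H G"
  shows "transitive_action G (lcosets H) (coset_action G H)"
proof -
  let ?X = "lcosets H" and ?\<phi> = "coset_action G H"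
  have app: "?\<phi> g C = g <# C" if "C \<in> ?X" for g C
    using that by (simp add: coset_action_def)
  have assoc: "g <# (h <# C) = (g \<otimes> h) <# C"
    if "C \<in> ?X" "g \<in> carrier G" "h \<in> carrier G" for g h C
    using that H lcos_m_assoc lcosets_subset_carrier by blast
  have one: "\<one> <# C = C" if "C \<in> ?X" for C
    using that H lcos_mult_one lcosets_subset_carrier by blast
  have bij: "?\<phi> g \<in> Bij ?X" if g: "g \<in> carrier G" for g
  proof -
    have "bij_betw (?\<phi> g) ?X ?X"
      by (rule bij_betw_byWitness[where f' = "?\<phi> (inv g)"])
        (auto simp: app assoc one g l_coset_lcosets H)
    then show ?thesis
      by (simp add: Bij_def coset_action_def)
  qed
  have mult: "?\<phi> (g \<otimes> h) = compose ?X (?\<phi> g) (?\<phi> h)"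
    if "g \<in> carrier G" "h \<in> carrier G" for g h
    by (rule ext) (auto simp: compose_def coset_action_def assoc that l_coset_lcosets H)
  have "?\<phi> \<in> hom G (BijGroup ?X)"
    by (rule homI) (simp_all add: BijGroup_def bij mult)
  then have "group_hom G (BijGroup ?X) ?\<phi>"
    by (intro group_hom.intro group_hom_axioms.intro group_BijGroup is_group)
  then show ?thesis
  proof (intro transitive_action.intro transitive_action_axioms.intro group_action.intro)
    fix C D assume CD: "C \<in> ?X" "D \<in> ?X"
    then obtain a b where ab: "a \<in> carrier G" "C = a <# H" "b \<in> carrier G" "D = b <# H"
      by (metis lcosetsE)
    then have "?\<phi> (b \<otimes> inv a) C = D"
      using H CD by (simp add: app lcos_m_assoc subgroup.subset m_assoc)
    then show "\<exists>g\<in>carrier G. ?\<phi> g C = D"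
      using ab by blast
  qed
qed

text \<open>The conjugation condition in \<open>sub_EKR\<close> says that \<open>s\<close> and
  \<open>t\<close> send some coset \<open>u <# H\<close> to the same coset. So \<open>S\<close> is
  intersecting for the action on \<open>lcosets H\<close>, and \<open>card S = card H\<close> is the
  extremal size.\<close>

lemma strong_EKR_imp_sub_EKR:
  assumes fin: "finite (carrier G)" and EKR: "strong_EKR_group G"
  shows "sub_EKR G"
  unfolding sub_EKR_def
proof (intro allI impI, elim conjE)
  fix H S
  assume H: "subgroup H G" and S: "S \<subseteq> carrier G" and card: "card S = card H" and one: "\<one> \<in> S"
    and conj: "\<forall>s\<in>S. \<forall>t\<in>S. \<exists>u\<in>carrier G. inv u \<otimes> (inv s \<otimes> t) \<otimes> u \<in> H"
  let ?X = "lcosets H" and ?\<phi> = "coset_action G H"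
  interpret act: transitive_action G ?X ?\<phi>
    using H by (rule transitive_coset_action)
  have finX: "finite ?X" and neX: "?X \<noteq> {}"
    using fin lcosetsI[OF one_closed, of H] by (auto simp: LCOSETS_def)
  have lag: "card ?X * card H = order G"
    using l_lagrange[OF fin H] .
  have "intersecting G ?X ?\<phi> S"
    unfolding intersecting_def
  proof (intro conjI ballI S)
    fix s t assume st: "s \<in> S" "t \<in> S"
    then obtain u where u: "u \<in> carrier G" "inv u \<otimes> (inv s \<otimes> t) \<otimes> u \<in> H"
      using conj by blast
    have c: "s \<in> carrier G" "t \<in> carrier G"
      using st S by auto
    have "inv (s \<otimes> u) \<otimes> (t \<otimes> u) \<in> H"
      using u c by (simp add: inv_mult_group m_assoc)
    then have "t \<otimes> u \<in> (s \<otimes> u) <# H"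
      using u c H by (intro subgroup.lcos_module_rev is_group) auto
    then have "(s \<otimes> u) <# H = (t \<otimes> u) <# H"
      using H u c by (intro l_repr_independence) auto
    then have "?\<phi> s (u <# H) = ?\<phi> t (u <# H)"
      using H u c by (simp add: coset_action_def lcosetsI lcos_m_assoc subgroup.subset)
    then show "\<exists>x\<in>?X. ?\<phi> s x = ?\<phi> t x"
      using u lcosetsI by blast
  qed
  moreover have "real (card S) = real (order G) / real (card ?X)"
    using finX neX card unfolding lag[symmetric] by simp
  moreover have "strong_EKR_action G ?X ?\<phi>"
    using strong_EKR_groupD[OF EKR finX neX act.transitive_action_axioms] .
  ultimately obtain C where C: "C \<in> ?X" "S \<in> lcosets (stabilizer G ?\<phi> C)"
    unfolding strong_EKR_action_def by blast
  have stab: "subgroup (stabilizer G ?\<phi> C) G"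
    using C act.stabilizer_subgroup by blast
  \<comment> \<open>Cosets of one subgroup are equal or disjoint; \<open>S\<close> and the
    stabilizer share \<one>, so they coincide.\<close>
  then have "stabilizer G ?\<phi> C \<in> lcosets (stabilizer G ?\<phi> C)" "\<one> \<in> stabilizer G ?\<phi> C"
    using lcosetsI[OF one_closed] lcos_mult_one
    by (metis subgroup.subset, simp add: subgroup.one_closed)
  then have "S = stabilizer G ?\<phi> C"
    using lcos_disjoint[OF stab C(2)] one by blast
  then show "subgroup S G"
    using stab by simp
qed

end

section \<open>Passage to quotients\<close>

lemma (in group_hom) subgroup_hom_vimage:
  assumes "subgroup K H"
  shows "subgroup {g \<in> carrier G. h g \<in> K} G"
  using assms by unfold_locales (auto simp: subgroup.one_closed subgroup.m_closed subgroup.m_inv_closed)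

text \<open>Every fibre of \<open>h\<close> is a right coset of the kernel, and the preimage of
  \<open>T\<close> is the disjoint union of the fibres over \<open>T\<close>.\<close>

lemma (in group_hom) card_hom_vimage:
  assumes fin: "finite (carrier G)" and surj: "h ` carrier G = carrier H" and T: "T \<subseteq> carrier H"
  shows "card {g \<in> carrier G. h g \<in> T} = card (kernel G H h) * card T"
proof -
  have "{g \<in> carrier G. h g \<in> T} = (\<Union>t\<in>T. {g \<in> carrier G. h g = t})"
    by auto
  moreover have "card {g \<in> carrier G. h g = t} = card (kernel G H h)" if t: "t \<in> T" for t
  proof -
    obtain a where a: "a \<in> carrier G" "h a = t"
      using surj T t by (metis image_iff subsetD)
    have "bij_betw (\<lambda>k. k \<otimes> a) (kernel G H h) {g \<in> carrier G. h g = t}"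
      by (rule bij_betw_byWitness[where f' = "\<lambda>g. g \<otimes> inv a"])
        (use a in \<open>auto simp: kernel_def G.m_assoc\<close>)
    then show ?thesis
      by (simp add: bij_betw_same_card)
  qed
  moreover have "finite T"
    using fin surj T by (metis finite_imageI finite_subset)
  moreover have "card (\<Union>t\<in>T. {g \<in> carrier G. h g = t}) = (\<Sum>t\<in>T. card {g \<in> carrier G. h g = t})"
    using fin \<open>finite T\<close> by (intro card_UN_disjoint) auto
  ultimately show ?thesis
    by simp
qed

text \<open>Taking preimages multiplies the sizes of \<open>K\<close> and \<open>T\<close> by the
  same factor, the size of the kernel, and conjugating elements lift by surjectivity. Mapping the
  preimage of \<open>T\<close> back recovers \<open>T\<close>.\<close>

lemma (in group_hom) sub_EKR_hom_image:
  assumes fin: "finite (carrier G)" and surj: "h ` carrier G = carrier H" and EKR: "sub_EKR G"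
  shows "sub_EKR H"
  unfolding sub_EKR_def
proof (intro allI impI, elim conjE)
  fix K T
  assume K: "subgroup K H" and T: "T \<subseteq> carrier H" and card: "card T = card K"
    and one: "\<one>\<^bsub>H\<^esub> \<in> T"
    and conj: "\<forall>s\<in>T. \<forall>t\<in>T. \<exists>u\<in>carrier H. inv\<^bsub>H\<^esub> u \<otimes>\<^bsub>H\<^esub> (inv\<^bsub>H\<^esub> s \<otimes>\<^bsub>H\<^esub> t) \<otimes>\<^bsub>H\<^esub> u \<in> K"
  let ?v = "\<lambda>T. {g \<in> carrier G. h g \<in> T}"
  have "subgroup (?v K) G"
    using K by (rule subgroup_hom_vimage)
  moreover have "card (?v T) = card (?v K)"
    using fin surj T K card by (simp add: card_hom_vimage subgroup.subset)
  moreover have "\<exists>u\<in>carrier G. inv u \<otimes> (inv s \<otimes> t) \<otimes> u \<in> ?v K" if "s \<in> ?v T" "t \<in> ?v T" for s t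
  proof -
    obtain w where w: "w \<in> carrier H" "inv\<^bsub>H\<^esub> w \<otimes>\<^bsub>H\<^esub> (inv\<^bsub>H\<^esub> (h s) \<otimes>\<^bsub>H\<^esub> h t) \<otimes>\<^bsub>H\<^esub> w \<in> K"
      using conj \<open>s \<in> ?v T\<close> \<open>t \<in> ?v T\<close> by blast
    moreover obtain u where "u \<in> carrier G" "w = h u"
      using w surj by blast
    ultimately show ?thesis
      using that by (intro bexI[of _ u]) auto
  qed
  moreover have "?v T \<subseteq> carrier G" "\<one> \<in> ?v T"
    using one by auto
  ultimately have "subgroup (?v T) G"
    using EKR unfolding sub_EKR_def by blast
  then have "subgroup (h ` ?v T) H"
    by (rule subgroup_img_is_subgroup)
  moreover have "h ` ?v T = T"
    using surj T by auto
  ultimately show "subgroup T H"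
    by simp
qed


section \<open>Commutation up to a central element\<close>

definition center :: "('a, 'm) monoid_scheme \<Rightarrow> 'a set"
  where "center G = {z \<in> carrier G. \<forall>g\<in>carrier G. z \<otimes>\<^bsub>G\<^esub> g = g \<otimes>\<^bsub>G\<^esub> z}"

context group
begin

lemma center_closed: "z \<in> center G \<Longrightarrow> z \<in> carrier G"
  by (simp add: center_def)

lemma center_commute: "z \<in> center G \<Longrightarrow> g \<in> carrier G \<Longrightarrow> z \<otimes> g = g \<otimes> z"
  by (simp add: center_def)

lemma center_lcomm:
  assumes "z \<in> center G" "g \<in> carrier G" "h \<in> carrier G"
  shows "g \<otimes> (z \<otimes> h) = z \<otimes> (g \<otimes> h)"
  using assms by (metis center_closed center_commute m_assoc)

lemma center_pow [simp]: "z \<in> center G \<Longrightarrow> z [^] (n::nat) \<in> center G"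
  by (simp add: center_def group_commutes_pow)

lemma subgroup_center: "subgroup (center G) G"
proof
  show "center G \<subseteq> carrier G" "\<one> \<in> center G"
    by (simp_all add: center_def subset_iff)
next
  fix x y assume xy: "x \<in> center G" "y \<in> center G"
  note [simp] = xy[THEN center_closed]
  have "(x \<otimes> y) \<otimes> g = g \<otimes> (x \<otimes> y)" if "g \<in> carrier G" for g
    using that xy by (simp add: m_assoc center_commute[of y g] center_lcomm[of x g y])
  then show "x \<otimes> y \<in> center G"
    by (simp add: center_def)
next
  fix x assume x: "x \<in> center G"
  note [simp] = x[THEN center_closed]
  have "inv x \<otimes> g = g \<otimes> inv x" if "g \<in> carrier G" for g
    using that arg_cong[OF center_commute[OF x, of "inv g"], of "m_inv G"]
    by (simp add: inv_mult_group)
  then show "inv x \<in> center G"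
    by (simp add: center_def)
qed

lemmas [simp] = center_closed

text \<open>By \<open>eq\<close>, the commutator of \<open>x\<close> and \<open>y\<close> is the
  central element \<open>d\<close>; each of the \<open>n\<close> factors \<open>x\<close> that
  passes \<open>y\<close> contributes one \<open>d\<close>.\<close>

lemma center_twist_pow:
  assumes d: "d \<in> center G" and x: "x \<in> carrier G" and y: "y \<in> carrier G"
    and eq: "x \<otimes> y = d \<otimes> (y \<otimes> x)"
  shows "x [^] (n::nat) \<otimes> y = d [^] n \<otimes> (y \<otimes> x [^] n)"
proof (induction n)
  case (Suc n)
  have "x [^] Suc n \<otimes> y = x [^] n \<otimes> (d \<otimes> (y \<otimes> x))"
    using x y by (simp add: m_assoc eq)
  also have "\<dots> = d \<otimes> ((x [^] n \<otimes> y) \<otimes> x)"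
    using d x y by (simp add: m_assoc center_lcomm)
  also have "\<dots> = d [^] Suc n \<otimes> (y \<otimes> x [^] Suc n)"
    using d x y by (simp add: Suc.IH m_assoc center_lcomm[of d "d [^] n"])
  finally show ?case .
qed (use y in simp)

lemma center_twist_pow2:
  assumes d: "d \<in> center G" and x: "x \<in> carrier G" and y: "y \<in> carrier G"
    and eq: "x \<otimes> y = d \<otimes> (y \<otimes> x)"
  shows "x \<otimes> y [^] (n::nat) = d [^] n \<otimes> (y [^] n \<otimes> x)"
proof (induction n)
  case (Suc n)
  have "x \<otimes> y [^] Suc n = (x \<otimes> y [^] n) \<otimes> y"
    using x y by (simp add: m_assoc)
  also have "\<dots> = d [^] n \<otimes> (y [^] n \<otimes> (x \<otimes> y))"
    using d x y by (simp add: Suc.IH m_assoc)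
  also have "\<dots> = d [^] Suc n \<otimes> (y [^] Suc n \<otimes> x)"
    using d x y by (simp add: eq m_assoc center_lcomm[of d "y [^] n"])
  finally show ?case .
qed (use x in simp)

text \<open>Among the letters of the \<open>n\<close>-th power of \<open>x \<otimes> y\<close> there
  are \<open>n choose 2\<close> pairs with a \<open>y\<close> before an \<open>x\<close>; sorting
  exchanges each pair once, at the cost of one factor \<open>inv d\<close>.\<close>

lemma center_twist_mult_pow:
  assumes d: "d \<in> center G" and x: "x \<in> carrier G" and y: "y \<in> carrier G"
    and eq: "x \<otimes> y = d \<otimes> (y \<otimes> x)"
  shows "d [^] (n choose 2) \<otimes> (x \<otimes> y) [^] n = x [^] n \<otimes> y [^] n"
proof (induction n)
  case (Suc n)
  have ch: "Suc n choose 2 = n + (n choose 2)"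
    by (simp add: numeral_2_eq_2)
  have "d [^] (Suc n choose 2) = d [^] n \<otimes> d [^] (n choose 2)"
    using d by (simp add: ch nat_pow_mult)
  then have "d [^] (Suc n choose 2) \<otimes> (x \<otimes> y) [^] Suc n
      = d [^] n \<otimes> ((d [^] (n choose 2) \<otimes> (x \<otimes> y) [^] n) \<otimes> (x \<otimes> y))"
    using d x y by (simp add: m_assoc)
  also have "\<dots> = x [^] n \<otimes> ((d [^] n \<otimes> (y [^] n \<otimes> x)) \<otimes> y)"
    using d x y unfolding Suc.IH by (simp add: m_assoc center_lcomm[of "d [^] n" "x [^] n"])
  also have "\<dots> = x [^] n \<otimes> ((x \<otimes> y [^] n) \<otimes> y)"
    unfolding center_twist_pow2[OF d x y eq] ..
  also have "\<dots> = x [^] Suc n \<otimes> y [^] Suc n"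
    using d x y by (simp add: m_assoc)
  finally show ?case .
qed (simp add: numeral_2_eq_2)

section \<open>Elements of order p with a central commutator\<close>

lemma ord_prime:
  assumes "x \<in> carrier G" "x \<noteq> \<one>" "prime (p::nat)" "x [^] p = \<one>"
  shows "ord x = p"
  using assms by (metis One_nat_def ord_eq_1 pow_eq_id prime_nat_iff)

lemma pow_eq_pow_iff:
  assumes "x \<in> carrier G"
  shows "x [^] (m::nat) = x [^] (n::nat) \<longleftrightarrow> int (ord x) dvd int n - int m"
  using int_pow_eq[OF assms, of "int m" "int n"] by (simp add: int_pow_int)

text \<open>The set \<open>S\<close> arises from \<open>K\<close>, generated by \<open>x\<close>, by
  exchanging the square of \<open>x\<close> for \<open>w\<close>. It has the size of
  \<open>K\<close> and meets the conjugation condition, yet contains \<open>x\<close> and not its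
  square. Oddness of \<open>p\<close> makes the square differ from \<one>, so that \<one> stays in
  \<open>S\<close>.\<close>

lemma sub_EKR_no_twisted_order_p:
  assumes fin: "finite (carrier G)" and EKR: "sub_EKR G"
    and p: "prime (p::nat)" "odd p"
    and x: "x \<in> carrier G" "x [^] p = \<one>" and g: "g \<in> carrier G"
    and z: "z \<in> center G" "z \<noteq> \<one>" and xg: "x \<otimes> g = z \<otimes> (g \<otimes> x)"
  shows False
proof -
  note [simp] = center_closed[OF z(1)] x(1) g
  have zc: "z [^] k \<in> center G" for k :: nat
    using z by simp
  have tw: "x [^] k \<otimes> g = z [^] k \<otimes> (g \<otimes> x [^] k)" for k :: nat
    using center_twist_pow[OF z(1) x(1) g xg] .
  have "z [^] p \<otimes> g = g"
    using tw[of p] x by simp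
  then have "z [^] p = \<one>"
    by simp
  then have oz: "ord z = p"
    by (rule ord_prime[OF center_closed[OF z(1)] z(2) p(1)])
  have x1: "x \<noteq> \<one>"
  proof
    assume "x = \<one>"
    then show False
      using xg z(2) by simp
  qed
  then have ox: "ord x = p"
    using x p by (intro ord_prime)
  have p3: "p \<ge> 3"
    using p prime_ge_2_nat[of p] by (cases "p = 2") auto
  define K where "K = generate G {x}"
  have K: "K = {x [^] k | k. k \<in> (UNIV::nat set)}"
    unfolding K_def using fin x by (intro generate_pow_on_finite_carrier)
  have subK: "subgroup K G"
    unfolding K_def by (simp add: generate_is_subgroup)
  have finK: "finite K"
    using fin subK by (meson finite_subset subgroup.subset)
  have x2K: "x [^] (2::nat) \<in> K"
    unfolding K by blast
  define w where "w = z \<otimes> x [^] (2::nat)"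
  have w: "w \<in> carrier G"
    by (simp add: w_def)
  have wK: "w \<notin> K"
  proof
    assume "w \<in> K"
    then obtain k :: nat where k: "z \<otimes> x [^] (2::nat) = x [^] k"
      by (auto simp: K w_def)
    \<comment> \<open>Moving \<open>g\<close> past \<open>x [^] k\<close> yields the factor
      \<open>z [^] k\<close>; reading the same element as \<open>z\<close> times the square of
      \<open>x\<close> yields \<open>z [^] 2\<close>. Hence \<open>k\<close> is 2 modulo
      \<open>p\<close>, which forces \<open>z\<close> to be \<one>.\<close>
    have "z [^] k \<otimes> (g \<otimes> x [^] k) = x [^] k \<otimes> g"
      by (simp add: tw)
    also have "\<dots> = z \<otimes> (x [^] (2::nat) \<otimes> g)"
      by (simp add: m_assoc flip: k)
    also have "\<dots> = z [^] (2::nat) \<otimes> (g \<otimes> x [^] k)"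
      using z by (simp only: tw) (simp add: center_lcomm[of z] m_assoc flip: k)
    finally have "z [^] k = z [^] (2::nat)"
      by simp
    then have "x [^] k = x [^] (2::nat)"
      by (simp add: pow_eq_pow_iff ox oz)
    then show False
      using k z by simp
  qed
  define S where "S = insert w (K - {x [^] (2::nat)})"
  have SG: "S \<subseteq> carrier G"
    using w subK by (auto simp: S_def dest: subgroup.mem_carrier)
  have x2: "x [^] (2::nat) \<noteq> \<one>"
    using ox p3 pow_eq_id[of x 2] by (auto dest: dvd_imp_le)
  have "card S = card K"
    using finK wK card_Suc_Diff1[OF finK x2K] by (simp add: S_def)
  moreover have "\<one> \<in> S"
    using subK x2 by (auto simp: S_def subgroup.one_closed)
  moreover
  let ?C = "\<lambda>s t. \<exists>u\<in>carrier G. inv u \<otimes> (inv s \<otimes> t) \<otimes> u \<in> K"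
  have C_sym: "?C t s" if "?C s t" "s \<in> carrier G" "t \<in> carrier G" for s t
  proof -
    obtain u where u: "u \<in> carrier G" "inv u \<otimes> (inv s \<otimes> t) \<otimes> u \<in> K"
      using \<open>?C s t\<close> by blast
    have "inv (inv u \<otimes> (inv s \<otimes> t) \<otimes> u) = inv u \<otimes> (inv t \<otimes> s) \<otimes> u"
      using u that by (simp add: inv_mult_group m_assoc)
    then show ?thesis
      using u subK by (metis subgroup.m_inv_closed)
  qed
  have C_w: "?C s w" if s: "s \<in> K" "s \<noteq> x [^] (2::nat)" for s
  proof -
    have "inv s \<otimes> x [^] (2::nat) \<in> K"
      using s subK x2K by (simp add: subgroup.m_closed subgroup.m_inv_closed)
    then obtain j :: nat where j: "inv s \<otimes> x [^] (2::nat) = x [^] j"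
      by (auto simp: K)
    have sG: "s \<in> carrier G"
      using s subK by (rule_tac subgroup.mem_carrier)
    have "x [^] j \<noteq> \<one>"
      using s sG j[symmetric] by (auto simp: inv_solve_left')
    then have "\<not> p dvd j"
      using ox pow_eq_id[of x j] by simp
    then have "coprime j p"
      using prime_imp_coprime[OF p(1)] by (simp add: coprime_commute)
    then obtain i where i: "[j * i = 1] (mod p)"
      using cong_solve_coprime_nat[of j p] by auto
    \<comment> \<open>This \<open>m\<close> solves \<open>j * m = -1\<close> modulo
      \<open>p\<close>. Moving \<open>g [^] m\<close> past \<open>x [^] j\<close> produces
      \<open>z [^] (j * m)\<close>, which cancels the \<open>z\<close> contained in
      \<open>w\<close>.\<close>
    define m where "m = (p - 1) * i"
    have "[j * m + 1 = (p - 1) * 1 + 1] (mod p)"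
      unfolding m_def using i by (metis cong_add_rcancel_nat cong_scalar_left mult.left_commute)
    then have "p dvd j * m + 1"
      using p3 by (simp add: cong_def dvd_eq_mod_eq_0)
    then have zj: "(z [^] j) [^] m \<otimes> z = \<one>"
      using oz pow_eq_id[of z "j * m + 1"] by (simp add: nat_pow_pow)
    have gm: "x [^] j \<otimes> g [^] m = (z [^] j) [^] m \<otimes> (g [^] m \<otimes> x [^] j)"
      by (rule center_twist_pow2[OF zc]) (simp_all add: tw)
    have "(inv s \<otimes> w) \<otimes> g [^] m = z \<otimes> (x [^] j \<otimes> g [^] m)"
      using sG z by (simp add: w_def center_lcomm[of z] m_assoc flip: j)
    also have "\<dots> = ((z [^] j) [^] m \<otimes> z) \<otimes> (g [^] m \<otimes> x [^] j)"
      using z zc by (simp add: gm center_lcomm[of z] m_assoc)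
    also have "\<dots> = g [^] m \<otimes> x [^] j"
      by (simp add: zj)
    finally have "inv (g [^] m) \<otimes> (inv s \<otimes> w) \<otimes> g [^] m = x [^] j"
      using sG w by (simp add: m_assoc flip: inv_solve_left')
    then show ?thesis
      by (intro bexI[of _ "g [^] m"]) (auto simp: K)
  qed
  have "\<forall>s\<in>S. \<forall>t\<in>S. ?C s t"
  proof (intro ballI)
    fix s t assume st: "s \<in> S" "t \<in> S"
    consider "s \<in> K" "t \<in> K" | "s = w" "t = w" | "s \<in> K" "s \<noteq> x [^] (2::nat)" "t = w"
      | "t \<in> K" "t \<noteq> x [^] (2::nat)" "s = w"
      using st by (auto simp: S_def)
    then show "?C s t"
    proof cases
      case 1
      then have "inv s \<otimes> t \<in> K" "s \<in> carrier G" "t \<in> carrier G"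
        using subK SG st by (auto simp: subgroup.m_closed subgroup.m_inv_closed)
      then show ?thesis
        by (intro bexI[of _ \<one>]) auto
    next
      case 2
      then show ?thesis
        using w subK by (intro bexI[of _ \<one>]) (auto simp: subgroup.one_closed)
    next
      case 3
      then show ?thesis
        using C_w by blast
    next
      case 4
      then show ?thesis
        using C_w C_sym w SG st by blast
    qed
  qed
  ultimately have subS: "subgroup S G"
    using EKR subK SG unfolding sub_EKR_def by blast
  have "x = x [^] (1::nat)"
    by simp
  then have "x \<in> K"
    unfolding K by blast
  moreover have "x \<noteq> x [^] (2::nat)"
    using x1 by (simp add: numeral_2_eq_2)
  ultimately have "x \<in> S"
    by (simp add: S_def)
  then have "x [^] (2::nat) \<in> S"
    using subS by (simp add: numeral_2_eq_2 subgroup.m_closed)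
  then show False
    using z by (simp add: S_def w_def)
qed

end


context group
begin

section \<open>Centrality of elements of odd prime power order\<close>

lemma central_cyclic_normal:
  assumes "c \<in> center G"
  shows "generate G {c} \<lhd> G"
proof (rule normal_invI)
  show sub: "subgroup (generate G {c}) G"
    using assms by (intro generate_is_subgroup) simp
  fix x h assume x: "x \<in> carrier G" and h: "h \<in> generate G {c}"
  have "generate G {c} \<subseteq> center G"
    using assms by (intro generate_subgroup_incl subgroup_center) simp
  with h have "h \<in> center G"
    by blast
  then have "x \<otimes> h \<otimes> inv x = h"
    using x by (simp add: m_assoc flip: center_commute[of h])
  then show "x \<otimes> h \<otimes> inv x \<in> generate G {c}"
    using h by simp
qed

lemma exists_pow_prime_order:
  assumes fin: "finite (carrier G)" and c: "c \<in> carrier G" "c \<noteq> \<one>"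
  obtains q k :: nat where "prime q" "ord (c [^] k) = q"
proof -
  have o: "ord c \<noteq> 1" "ord c \<noteq> 0"
    using c fin ord_ge_1[OF fin c(1)] by (auto simp: ord_eq_1[simplified])
  then obtain q where q: "prime q" "q dvd ord c"
    using prime_factor_nat by blast
  have "ord (c [^] (ord c div q)) = ord c div (ord c div q)"
    using q o c by (intro ord_pow) (auto elim!: dvdE)
  also have "\<dots> = q"
    using q o by (auto elim!: dvdE)
  finally show ?thesis
    using q that by blast
qed

text \<open>The hypotheses describe a minimal counterexample: by \<open>quot\<close>, elements of
  \<open>p\<close>-power order become central modulo every non-trivial normal subgroup. Take a
  non-central one, \<open>x\<close>, of least order \<open>p ^ n\<close>. The case
  \<open>n = 1\<close> is excluded by \<open>sub_EKR_no_twisted_order_p\<close>; for larger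
  \<open>n\<close>, a suitable product of powers of \<open>x\<close> and of another
  \<open>p\<close>-element is non-central of smaller order.\<close>

lemma commutes_if_minimal_nonabelian:
  assumes fin: "finite (carrier G)" and EKR: "sub_EKR G"
    and p: "prime (p::nat)" "odd p"
    and c: "c \<in> center G" "c \<noteq> \<one>"
    and quot: "\<And>N h g k. \<lbrakk>N \<lhd> G; N \<noteq> {\<one>}; h \<in> carrier G; g \<in> carrier G; h [^] (p ^ k) = \<one>\<rbrakk>
      \<Longrightarrow> h \<otimes> g \<otimes> inv h \<otimes> inv g \<in> N"
    and h: "h \<in> carrier G" "h [^] (p ^ k) = \<one>" and g: "g \<in> carrier G"
  shows "h \<otimes> g = g \<otimes> h"
proof (rule ccontr)
  assume nc: "h \<otimes> g \<noteq> g \<otimes> h"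
  \<comment> \<open>The subgroup generated by a central \<open>c\<close> is normal, so
    \<open>quot\<close> places the commutator of \<open>h\<close> and \<open>g\<close> inside it.
    The freedom to choose \<open>c\<close> is exploited again in \<open>top\<close>.\<close>
  have twist: "\<exists>i::nat. h \<otimes> g = c [^] i \<otimes> (g \<otimes> h)"
    if c: "c \<in> center G" "c \<noteq> \<one>" and h: "h \<in> carrier G" "h [^] (p ^ k) = \<one>" and g: "g \<in> carrier G"
    for c h g k
  proof -
    have "c \<in> generate G {c}"
      by (simp add: generate.incl)
    then have "generate G {c} \<noteq> {\<one>}"
      using c by blast
    then have "h \<otimes> g \<otimes> inv h \<otimes> inv g \<in> generate G {c}"
      using quot[OF central_cyclic_normal] c h g by blast
    then obtain i :: nat where i: "h \<otimes> g \<otimes> inv h \<otimes> inv g = c [^] i"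
      using generate_pow_on_finite_carrier[OF fin center_closed[OF c(1)]] by blast
    have cancel: "a \<otimes> inv b \<otimes> b = a" if "a \<in> carrier G" "b \<in> carrier G" for a b
      using that by (simp add: m_assoc)
    have "c [^] i \<otimes> (g \<otimes> h) = (h \<otimes> g \<otimes> inv h \<otimes> inv g) \<otimes> (g \<otimes> h)"
      by (simp add: i)
    also have "\<dots> = h \<otimes> g"
      using h(1) g cancel by (simp flip: m_assoc)
    finally show ?thesis
      by metis
  qed
  obtain q l :: nat where q: "prime q" "ord (c [^] l) = q"
    using exists_pow_prime_order[OF fin] c by (metis center_closed)
  define e where "e = c [^] l"
  have e: "e \<in> center G" "ord e = q"
    using c q by (auto simp: e_def)
  then have e1: "e \<noteq> \<one>"
    using q by auto
  have eq: "e [^] q = \<one>"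
    using e pow_ord_eq_1[of e] by simp
  \<comment> \<open>The commutator of \<open>h\<close> and \<open>g\<close> is a non-trivial power
    of \<open>e\<close>, so its order is \<open>q\<close>; since \<open>h\<close> is killed by
    \<open>p ^ k\<close>, so is this commutator.\<close>
  have "q = p"
  proof -
    obtain i :: nat where i: "h \<otimes> g = e [^] i \<otimes> (g \<otimes> h)"
      using twist e e1 h g by blast
    have "(e [^] i) [^] (p ^ k) \<otimes> g = g"
      using center_twist_pow[OF center_pow[OF e(1)] h(1) g i, of "p ^ k"] h g e by simp
    then have "e [^] (i * p ^ k) = \<one>"
      using g e by (simp add: nat_pow_pow)
    then have "q dvd i * p ^ k"
      using e by (simp add: pow_eq_id)
    moreover have "\<not> q dvd i"
    proof
      assume "q dvd i"
      then have "e [^] i = \<one>"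
        using e by (simp add: pow_eq_id)
      then show False
        using i nc h g by simp
    qed
    ultimately have "q dvd p"
      using q(1) by (meson prime_dvd_mult_iff prime_dvd_power)
    then show ?thesis
      using q(1) p(1) primes_dvd_imp_eq by blast
  qed
  have comm: "\<exists>d \<in> center G. d [^] p = \<one> \<and> h \<otimes> g = d \<otimes> (g \<otimes> h)"
    if h: "h \<in> carrier G" "h [^] (p ^ k) = \<one>" and g: "g \<in> carrier G" for h g k
  proof -
    obtain i :: nat where i: "h \<otimes> g = e [^] i \<otimes> (g \<otimes> h)"
      using twist e e1 h g by blast
    have "(e [^] i) [^] p = (e [^] q) [^] i"
      using e by (simp add: nat_pow_pow mult.commute \<open>q = p\<close>)
    then show ?thesis
      using i e eq by auto
  qed
  define noncentral where "noncentral =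
    (\<lambda>x. x \<in> carrier G \<and> (\<exists>k. x [^] (p ^ k) = \<one>) \<and> x \<notin> center G)"
  have "noncentral h"
    using h nc g by (auto simp: noncentral_def center_def simp del: center_closed)
  then obtain x where x: "noncentral x" and min: "\<And>y. noncentral y \<Longrightarrow> ord x \<le> ord y"
    using ex_has_least_nat[of noncentral h ord] by metis
  obtain K where xG: "x \<in> carrier G" and xK: "x [^] (p ^ K) = \<one>"
    using x by (auto simp: noncentral_def)
  obtain g0 where g0: "g0 \<in> carrier G" "x \<otimes> g0 \<noteq> g0 \<otimes> x"
    using x xG by (auto simp: noncentral_def center_def simp del: center_closed)
  obtain d where d: "d \<in> center G" "d [^] p = \<one>" "x \<otimes> g0 = d \<otimes> (g0 \<otimes> x)"
    using comm xG xK g0 by blast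
  have d1: "d \<noteq> \<one>"
    using d g0 xG by auto
  have od: "ord d = p"
    using d d1 p by (intro ord_prime) auto
  obtain n where n: "ord x = p ^ n"
    using xK xG p by (metis pow_eq_id divides_primepow_nat)
  have ppow_closed: "\<exists>k. (y [^] j) [^] (p ^ k) = \<one>"
    if "y \<in> carrier G" "y [^] (p ^ k) = \<one>" for y k and j :: nat
  proof -
    have "(y [^] j) [^] (p ^ k) = (y [^] (p ^ k)) [^] j"
      using that(1) by (simp add: nat_pow_pow mult.commute)
    then show ?thesis
      using that by auto
  qed
  have "n \<noteq> 0"
  proof
    assume "n = 0"
    then have "x = \<one>"
      using n xG ord_eq_1 by simp
    then show False
      using g0 by simp
  qed
  moreover have "n \<noteq> 1"
  proof
    assume "n = 1"
    then have "x [^] p = \<one>"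
      using n xG pow_ord_eq_1[of x] by simp
    then show False
      using sub_EKR_no_twisted_order_p[OF fin EKR p xG _ g0(1) d(1) d1 d(3)] by blast
  qed
  ultimately obtain n' where n': "n = Suc (Suc n')"
    by (metis One_nat_def old.nat.exhaust)
  \<comment> \<open>Replacing \<open>g0\<close> by its \<open>p\<close>-part; it still does not commute with \<open>x\<close>.\<close>
  obtain m r where mr: "ord g0 = p ^ m * r" "\<not> p dvd r"
    using p ord_ge_1[OF fin g0(1)] multiplicity_decompose'[of "ord g0" p]
    by (metis not_one_le_zero not_prime_unit)
  define y where "y = g0 [^] r"
  define D where "D = d [^] r"
  have yG: "y \<in> carrier G"
    using g0 by (simp add: y_def)
  have D: "D \<in> center G"
    using d by (simp add: D_def)
  have D1: "D \<noteq> \<one>"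
    using mr od d pow_eq_id[of d r] by (simp add: D_def)
  have Dp: "D [^] p = \<one>"
    using d by (simp add: D_def nat_pow_pow mult.commute[of r]) (simp flip: nat_pow_pow)
  have xy: "x \<otimes> y = D \<otimes> (y \<otimes> x)"
    unfolding y_def D_def by (rule center_twist_pow2[OF d(1) xG g0(1) d(3)])
  have oy: "ord y = p ^ m"
    unfolding y_def using mr ord_ge_1[OF fin g0(1)] g0 by (subst ord_pow) auto
  have yp: "y [^] (p ^ m) = \<one>"
    using oy yG pow_ord_eq_1[of y] by simp
  have "y \<notin> center G"
    using xy D1 D xG yG center_commute[of y x] by (auto simp: l_cancel_one)
  \<comment> \<open>Minimality of \<open>ord x\<close> now gives \<open>n \<le> m\<close>, so that
    \<open>m - n\<close> in the exponent of \<open>u\<close> below is a true difference.\<close>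
  then have "noncentral y"
    using yG yp by (auto simp: noncentral_def)
  then have "p ^ n \<le> p ^ m"
    using min n oy by metis
  then have nm: "n \<le> m"
    using p prime_gt_1_nat power_le_imp_le_exp by blast
  \<comment> \<open>The commutator of \<open>u [^] p\<close> with \<open>v\<close> is the
    \<open>p\<close>-th power of that of \<open>u\<close> with \<open>v\<close>, hence
    trivial.\<close>
  have pth_central: "u [^] p \<in> center G" if u: "u \<in> carrier G" "u [^] (p ^ k) = \<one>" for u k
    proof -
    have "u [^] p \<otimes> v = v \<otimes> u [^] p" if v: "v \<in> carrier G" for v
    proof -
      obtain f where f: "f \<in> center G" "f [^] p = \<one>" "u \<otimes> v = f \<otimes> (v \<otimes> u)"
        using comm u v by blast
      show ?thesis
        using center_twist_pow[OF f(1) u(1) v f(3), of p] f u v by simp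
    qed
    then show ?thesis
      using u by (simp add: center_def del: center_closed)
  qed
  \<comment> \<open>For \<open>j \<ge> 2\<close> the element \<open>u [^] (p ^ (j - 1))\<close> is a
    power of the central \<open>u [^] p\<close>, and it is not \<one>. So \<open>twist\<close>
    applies with it in place of \<open>c\<close>, to the pair \<open>x\<close>, \<open>y\<close>
    with commutator \<open>D\<close>. Applied to \<open>x\<close> and to \<open>y\<close>, this
    writes \<open>D\<close> as a power of each.\<close>
  have top: "\<exists>i::nat. D = (u [^] (p ^ (j - 1))) [^] i"
    if u: "u \<in> carrier G" "ord u = p ^ j" and j: "j \<ge> 2" for u j
  proof -
    have "u [^] (p ^ j) = \<one>"
      using u pow_ord_eq_1[of u] by simp
    then have "u [^] p \<in> center G"
      using pth_central u by blast
    then have "(u [^] p) [^] (p ^ (j - 2)) \<in> center G"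
      by simp
    moreover have "j - 1 = Suc (j - 2)"
      using j by simp
    ultimately have cen: "u [^] (p ^ (j - 1)) \<in> center G"
      using u by (simp add: nat_pow_pow)
    have "\<not> p ^ j dvd p ^ (j - 1)"
      using p j prime_gt_1_nat[OF p(1)] by (simp add: power_dvd_imp_le dvd_power_iff_le)
    then have "u [^] (p ^ (j - 1)) \<noteq> \<one>"
      using u by (simp add: pow_eq_id)
    then obtain i :: nat where "x \<otimes> y = (u [^] (p ^ (j - 1))) [^] i \<otimes> (y \<otimes> x)"
      using twist[OF cen _ xG xK yG] by blast
    then show ?thesis
      using xy xG yG D u by auto
  qed
  obtain a :: nat where a: "D = (x [^] (p ^ (n - 1))) [^] a"
    using top[OF xG n] n' by auto
  obtain b :: nat where b: "D = (y [^] (p ^ (m - 1))) [^] b"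
    using top[OF yG oy] n' nm by auto
  define N where "N = p ^ (n - 1)"
  \<comment> \<open>\<open>w\<close> and \<open>u\<close> are chosen with inverse \<open>N\<close>-th powers, so that \<open>w \<otimes> u\<close> has smaller order than \<open>x\<close>.\<close>
  define w where "w = x [^] a"
  define u where "u = y [^] (p ^ (m - n) * b * (p - 1))"
  have wG: "w \<in> carrier G" and uG: "u \<in> carrier G"
    using xG yG by (auto simp: w_def u_def)
  have wN: "w [^] N = D"
    using xG by (simp add: w_def N_def a nat_pow_pow mult.commute)
  have "m - n + (n - 1) = m - 1"
    using nm n' by simp
  then have "p ^ (m - n) * b * (p - 1) * N = p ^ (m - 1) * b * (p - 1)"
    by (simp add: N_def flip: power_add)
  then have uN: "u [^] N = D [^] (p - 1)"
    using yG by (simp only: u_def b nat_pow_pow nat_pow_closed)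
  obtain i where wu: "w \<otimes> u = i \<otimes> (u \<otimes> w)" and i: "i \<in> center G" "i [^] p = \<one>"
    using comm[OF wG _ uG] ppow_closed[OF xG xK, of a] by (metis w_def)
  \<comment> \<open>This removes the correction factor in \<open>center_twist_mult_pow\<close>, as
    \<open>i [^] p = \<one>\<close>. It uses that \<open>p\<close> divides \<open>N\<close>, because
    \<open>n \<ge> 2\<close>, and that the odd \<open>p\<close> is coprime to the 2 in
    \<open>N * (N - 1) = 2 * (N choose 2)\<close>.\<close>
  have "p dvd N choose 2"
  proof -
    have "p dvd N"
      using n' by (simp add: N_def)
    then obtain t where t: "N = p * t" ..
    have "even (N * (N - 1))"
      by (cases "even N") auto
    then have "2 * (N choose 2) = p * (t * (N - 1))"
      by (simp add: choose_two t mult.assoc)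
    then have "p dvd 2 * (N choose 2)"
      by simp
    moreover have "coprime p 2"
      using p by (simp add: coprime_commute)
    ultimately show ?thesis
      using coprime_dvd_mult_right_iff by blast
  qed
  then have "i [^] (N choose 2) = \<one>"
    using i by (metis center_closed nat_pow_one nat_pow_pow dvdE)
  moreover have "D \<otimes> D [^] (p - 1) = \<one>"
    using Dp D p prime_gt_0_nat[OF p(1)] by (metis Suc_diff_1 center_closed nat_pow_Suc2)
  ultimately have tN: "(w \<otimes> u) [^] N = \<one>"
    using center_twist_mult_pow[OF i(1) wG uG wu, of N] wG uG wN uN by simp
  \<comment> \<open>As a power of \<open>y\<close>, the factor \<open>u\<close> commutes with
    \<open>y\<close>; only \<open>w\<close>, a power of \<open>x\<close>, contributes to the
    commutator.\<close>
  have "(w \<otimes> u) \<otimes> y = D [^] a \<otimes> (y \<otimes> (w \<otimes> u))"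
  proof -
    have "u \<otimes> y = y \<otimes> u"
      unfolding u_def using yG by (intro group_commutes_pow) auto
    then have "(w \<otimes> u) \<otimes> y = (w \<otimes> y) \<otimes> u"
      using wG uG yG by (simp add: m_assoc)
    also have "w \<otimes> y = D [^] a \<otimes> (y \<otimes> w)"
      unfolding w_def by (rule center_twist_pow[OF D xG yG xy])
    finally show ?thesis
      using D wG uG yG by (simp add: m_assoc)
  qed
  \<comment> \<open>If \<open>p\<close> divided \<open>a\<close>, then \<open>D\<close>, the power
    of \<open>x\<close> with exponent \<open>p ^ (n - 1) * a\<close>, would be trivial.\<close>
  moreover have "D [^] a \<noteq> \<one>"
  proof
    assume "D [^] a = \<one>"
    then have "p dvd a"
      using D D1 Dp p ord_prime[of D p] pow_eq_id[of D a] by simp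
    then have "p ^ n dvd p ^ (n - 1) * a"
      using n' by (simp add: mult.commute)
    then have "D = \<one>"
      using a n xG by (simp add: nat_pow_pow pow_eq_id)
    then show False
      using D1 by simp
  qed
  ultimately have "w \<otimes> u \<notin> center G"
    using D wG uG yG center_commute[of "w \<otimes> u" y] by (auto simp: l_cancel_one)
  then have "noncentral (w \<otimes> u)"
    using wG uG tN by (auto simp: noncentral_def N_def)
  then have "ord x \<le> ord (w \<otimes> u)"
    by (rule min)
  also have "\<dots> \<le> N"
    using tN wG uG p prime_gt_0_nat[of p] by (intro dvd_imp_le) (auto simp: pow_eq_id N_def)
  also have "\<dots> < p ^ n"
    unfolding N_def using p n' prime_gt_1_nat by (intro power_strict_increasing) auto
  finally show False
    using n by simp
qed

end


section \<open>Reduction to a minimal quotient of a nilpotent group\<close>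

context group
begin

lemma lower_central_series_subset: "lower_central_series G n \<subseteq> carrier G"
proof (induction n)
  case (Suc n)
  have "(\<Union>h\<in>lower_central_series G n. \<Union>k\<in>carrier G. {h \<otimes> k \<otimes> inv h \<otimes> inv k}) \<subseteq> carrier G"
    using Suc.IH by (auto simp: subset_iff)
  then show ?case
    by (simp add: commutator_subgroup_def generate_incl)
qed simp

text \<open>The lower central series starts outside \<open>N\<close> and ends inside it. An element
  \<open>c\<close> of a term not contained in \<open>N\<close>, whose successor is contained in
  \<open>N\<close>, has all its commutators in \<open>N\<close>. Thus a non-trivial quotient has a
  non-trivial center.\<close>

lemma nilpotent_central_mod:
  assumes nil: "nilpotent_group G" and N: "N \<lhd> G" "N \<noteq> carrier G"
  obtains c where "c \<in> carrier G" "c \<notin> N"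
    "\<And>g. g \<in> carrier G \<Longrightarrow> c \<otimes> g \<otimes> inv c \<otimes> inv g \<in> N"
proof -
  let ?L = "lower_central_series G"
  have sub: "subgroup N G"
    using N by (simp add: normal_inv_iff)
  obtain n where "?L n = {\<one>}"
    using nil by (auto simp: nilpotent_group_def)
  then have "?L n \<subseteq> N"
    using sub by (simp add: subgroup.one_closed)
  moreover have "\<not> ?L 0 \<subseteq> N"
    using sub N by (auto dest: subgroup.subset)
  ultimately obtain i where i: "\<not> ?L i \<subseteq> N" "?L (Suc i) \<subseteq> N"
    using ex_least_nat_less[of "\<lambda>n. ?L n \<subseteq> N" n] by blast
  then obtain c where c: "c \<in> ?L i" "c \<notin> N"
    by blast
  have "c \<otimes> g \<otimes> inv c \<otimes> inv g \<in> ?L (Suc i)" if "g \<in> carrier G" for g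
    using c that by (auto simp: commutator_subgroup_def intro!: generate.incl)
  then show ?thesis
    using that c i lower_central_series_subset by blast
qed

lemma commutator_eq_one_iff:
  assumes "h \<in> carrier G" "g \<in> carrier G"
  shows "h \<otimes> g \<otimes> inv h \<otimes> inv g = \<one> \<longleftrightarrow> h \<otimes> g = g \<otimes> h"
proof -
  have "h \<otimes> g \<otimes> inv h \<otimes> inv g = (h \<otimes> g) \<otimes> inv (g \<otimes> h)"
    using assms by (simp add: inv_mult_group m_assoc)
  then show ?thesis
    using assms by (metis inv_solve_right' l_one m_closed one_closed r_inv)
qed

text \<open>For a largest \<open>bad\<close> subgroup \<open>N\<close>, the quotient by
  \<open>N\<close> meets the hypotheses of \<open>commutes_if_minimal_nonabelian\<close>: nilpotency
  supplies the central element, maximality of \<open>N\<close> supplies the condition on normal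
  subgroups.\<close>

lemma p_elements_central:
  assumes fin: "finite (carrier G)" and nil: "nilpotent_group G" and EKR: "sub_EKR G"
    and p: "prime (p::nat)" "odd p"
    and h: "h \<in> carrier G" "h [^] (p ^ k) = \<one>" and g: "g \<in> carrier G"
  shows "h \<otimes> g = g \<otimes> h"
proof (rule ccontr)
  assume nc: "h \<otimes> g \<noteq> g \<otimes> h"
  let ?comm = "\<lambda>h g. h \<otimes> g \<otimes> inv h \<otimes> inv g"
  \<comment> \<open>Stated inside \<open>G\<close>, this says that the quotient by \<open>N\<close>
    has a non-central element of \<open>p\<close>-power order.\<close>
  define bad where "bad = (\<lambda>N. N \<lhd> G \<and>
    (\<exists>h\<in>carrier G. \<exists>g\<in>carrier G. \<exists>k. h [^] (p ^ k) \<in> N \<and> ?comm h g \<notin> N))"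
  have sub: "N \<subseteq> carrier G" if "bad N" for N
    using that by (auto simp: bad_def normal_inv_iff dest: subgroup.mem_carrier)
  have "bad {\<one>}"
    using h g nc one_is_normal by (auto simp: bad_def commutator_eq_one_iff)
  moreover have "\<forall>N. bad N \<longrightarrow> card N \<le> order G"
    using sub fin by (auto simp: order_def intro: card_mono)
  ultimately obtain N where N: "bad N" and max: "\<And>M. bad M \<Longrightarrow> card M \<le> card N"
    using ex_has_greatest_nat[of bad "{\<one>}" card "Suc (order G)"] by (auto simp: less_Suc_eq_le)
  interpret N: normal N G
    using N by (simp add: bad_def)
  obtain h g k where hg: "h \<in> carrier G" "g \<in> carrier G" "h [^] (p ^ k) \<in> N" "?comm h g \<notin> N"
    using N by (auto simp: bad_def)
  let ?Q = "G Mod N" and ?\<pi> = "\<lambda>a. N #> a"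
  interpret Q: group ?Q
    by (rule N.factorgroup_is_group)
  interpret \<pi>: group_hom G ?Q ?\<pi>
    by (intro group_hom.intro group_hom_axioms.intro is_group Q.is_group N.r_coset_hom_Mod)
  have surj: "?\<pi> ` carrier G = carrier ?Q"
    by (simp add: carrier_FactGroup)
  have \<pi>1: "?\<pi> a = \<one>\<^bsub>?Q\<^esub> \<longleftrightarrow> a \<in> N" if "a \<in> carrier G" for a
    using that N.subgroup_axioms by (metis coset_join1 coset_join2 one_FactGroup N.subset)
  have pow: "?\<pi> a [^]\<^bsub>?Q\<^esub> (n::nat) = ?\<pi> (a [^] n)" if "a \<in> carrier G" for a n
    using that by (simp add: \<pi>.hom_nat_pow)
  have "N \<noteq> carrier G"
    using hg by auto
  then obtain c where c: "c \<in> carrier G" "c \<notin> N" "\<And>g. g \<in> carrier G \<Longrightarrow> ?comm c g \<in> N"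
    using nilpotent_central_mod[OF nil N.normal_axioms] by metis
  have comm\<pi>: "?\<pi> (?comm a b)
      = ?\<pi> a \<otimes>\<^bsub>?Q\<^esub> ?\<pi> b \<otimes>\<^bsub>?Q\<^esub> inv\<^bsub>?Q\<^esub> (?\<pi> a) \<otimes>\<^bsub>?Q\<^esub> inv\<^bsub>?Q\<^esub> (?\<pi> b)"
    if "a \<in> carrier G" "b \<in> carrier G" for a b
    using that by (simp only: \<pi>.hom_mult \<pi>.hom_inv inv_closed m_closed)
  have comm\<pi>_iff: "?comm a b \<in> N \<longleftrightarrow> ?\<pi> a \<otimes>\<^bsub>?Q\<^esub> ?\<pi> b = ?\<pi> b \<otimes>\<^bsub>?Q\<^esub> ?\<pi> a"
    if "a \<in> carrier G" "b \<in> carrier G" for a b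
    using that Q.commutator_eq_one_iff[of "?\<pi> a" "?\<pi> b"] comm\<pi>[OF that] \<pi>1[of "?comm a b"]
    by (simp only: \<pi>.hom_closed inv_closed m_closed simp_thms)
  have "?\<pi> h \<otimes>\<^bsub>?Q\<^esub> ?\<pi> g = ?\<pi> g \<otimes>\<^bsub>?Q\<^esub> ?\<pi> h"
  proof (rule Q.commutes_if_minimal_nonabelian[OF _ _ p])
    show "finite (carrier ?Q)"
      using fin surj by (metis finite_imageI)
    show "sub_EKR ?Q"
      by (rule \<pi>.sub_EKR_hom_image[OF fin surj EKR])
    show "?\<pi> c \<in> center ?Q"
      using c surj comm\<pi>_iff by (auto simp: center_def simp del: center_closed simp flip: surj)
    show "?\<pi> c \<noteq> \<one>\<^bsub>?Q\<^esub>"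
      using c \<pi>1 by blast
    show "?\<pi> h \<in> carrier ?Q" "?\<pi> g \<in> carrier ?Q"
      using hg \<pi>.hom_closed by auto
    show "?\<pi> h [^]\<^bsub>?Q\<^esub> (p ^ k) = \<one>\<^bsub>?Q\<^esub>"
      using hg \<pi>1 pow by simp
  next
    fix M h' g' k'
    assume M: "M \<lhd> ?Q" "M \<noteq> {\<one>\<^bsub>?Q\<^esub>}" and hg': "h' \<in> carrier ?Q" "g' \<in> carrier ?Q"
      and hk: "h' [^]\<^bsub>?Q\<^esub> (p ^ k') = \<one>\<^bsub>?Q\<^esub>"
    obtain a b where ab: "a \<in> carrier G" "h' = ?\<pi> a" "b \<in> carrier G" "g' = ?\<pi> b"
      using hg' surj by (metis imageE)
    have subM: "subgroup M ?Q"
      using M by (simp add: Q.normal_inv_iff)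
    \<comment> \<open>The preimage of \<open>M\<close> properly contains \<open>N\<close>, so it is
      not \<open>bad\<close>; its commutator condition, pushed forward along \<open>?\<pi>\<close>,
      is the required one for \<open>M\<close>.\<close>
    let ?M = "{g \<in> carrier G. ?\<pi> g \<in> M}"
    have normM: "?M \<lhd> G"
    proof (rule normal_invI)
      show "subgroup ?M G"
        using subM by (rule \<pi>.subgroup_hom_vimage)
      fix x y assume xy: "x \<in> carrier G" "y \<in> ?M"
      then have "?\<pi> (x \<otimes> y \<otimes> inv x) = ?\<pi> x \<otimes>\<^bsub>?Q\<^esub> ?\<pi> y \<otimes>\<^bsub>?Q\<^esub> inv\<^bsub>?Q\<^esub> (?\<pi> x)"
        by (simp only: \<pi>.hom_mult \<pi>.hom_inv inv_closed m_closed mem_Collect_eq)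
      also have "\<dots> \<in> M"
        using xy M \<pi>.hom_closed by (intro Q.normal_invE(2)) auto
      finally show "x \<otimes> y \<otimes> inv x \<in> ?M"
        using xy by auto
    qed
    have NM: "N \<subseteq> ?M"
    proof
      fix x assume x: "x \<in> N"
      then have "x \<in> carrier G"
        by (rule N.mem_carrier)
      moreover from this have "?\<pi> x \<in> M"
        using x \<pi>1 subgroup.one_closed[OF subM] by metis
      ultimately show "x \<in> ?M"
        by simp
    qed
    moreover have "N \<noteq> ?M"
    proof -
      obtain q where q: "q \<in> M" "q \<noteq> \<one>\<^bsub>?Q\<^esub>"
        using M subM subgroup.one_closed[OF subM] by blast
      then obtain x where "x \<in> carrier G" "q = ?\<pi> x"
        using surj subgroup.mem_carrier[OF subM] by (metis imageE)
      then show ?thesis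
        using q \<pi>1 by blast
    qed
    ultimately have "card N < card ?M"
      using fin by (intro psubset_card_mono) auto
    then have "\<not> bad ?M"
      using max by (metis not_le)
    moreover have "a [^] (p ^ k') \<in> ?M"
      using NM hk ab \<pi>1 pow by auto
    ultimately have "?comm a b \<in> ?M"
      using normM ab unfolding bad_def by blast
    then show "h' \<otimes>\<^bsub>?Q\<^esub> g' \<otimes>\<^bsub>?Q\<^esub> inv\<^bsub>?Q\<^esub> h' \<otimes>\<^bsub>?Q\<^esub> inv\<^bsub>?Q\<^esub> g' \<in> M"
      using ab comm\<pi> by simp
  qed
  then show False
    using hg comm\<pi>_iff by blast
qed

section \<open>Splitting off the Sylow 2-subgroup\<close>

lemma subgroup_pow_card:
  assumes "subgroup K G" "x \<in> K"
  shows "x [^] card K = \<one>"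
proof -
  have "x [^]\<^bsub>G\<lparr>carrier := K\<rparr>\<^esub> order (G\<lparr>carrier := K\<rparr>) = \<one>\<^bsub>G\<lparr>carrier := K\<rparr>\<^esub>"
    by (rule group.pow_order_eq_1[OF subgroup_imp_group[OF assms(1)]]) (simp add: assms)
  then show ?thesis
    unfolding nat_pow_consistent[of x _ K, symmetric] by (simp add: order_def)
qed

lemma subgroup_card_dvd:
  assumes "subgroup K G" "subgroup L G" "K \<subseteq> L"
  shows "card K dvd card L"
proof -
  have "card K dvd order (G\<lparr>carrier := L\<rparr>)"
    using group.lagrange[OF subgroup_imp_group[OF assms(2)] subgroup_incl[OF assms]]
    by (rule dvdI[OF trans[OF sym mult.commute]])
  then show ?thesis
    by (simp add: order_def)
qed

end

text \<open>With \<open>m\<close> the odd part of the order, \<open>P\<close> is a Sylow 2-subgroup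
  and \<open>A\<close> consists of the central elements killed by \<open>m\<close>. Centrality of
  all elements of odd prime power order makes \<open>A\<close> large enough to complement
  \<open>P\<close>.\<close>

theorem theorem3:
  fixes G :: "('a, 'm) monoid_scheme" (structure)
  assumes "group G"
    and "finite (carrier G)"
    and "\<not> comm_group G"
    and "nilpotent_group G"
    and "strong_EKR_group G"
  shows "\<exists>P A. subgroup P G \<and> subgroup A G \<and>
    (\<lambda>(x, y). x \<otimes> y) \<in> iso (G\<lparr>carrier := P\<rparr> \<times>\<times> G\<lparr>carrier := A\<rparr>) G \<and>
    (\<exists>k. card P = 2 ^ k) \<and>
    comm_group (G\<lparr>carrier := A\<rparr>) \<and> odd (card A)"
proof -
  interpret group G by fact
  note fin = \<open>finite (carrier G)\<close>
  have central: "x \<in> center G"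
    if "prime p" "odd p" "x \<in> carrier G" "x [^] (p ^ k) = \<one>" for p k :: nat and x
    using that p_elements_central[OF fin assms(4) strong_EKR_imp_sub_EKR[OF fin assms(5)]]
    by (auto simp: center_def simp del: center_closed)
  have ord0: "order G \<noteq> 0"
    using fin by (simp add: order_gt_0_iff_finite)
  obtain k m where km: "order G = 2 ^ k * m" "odd m"
  proof -
    obtain m where "order G = 2 ^ multiplicity 2 (order G) * m" "odd m"
      using multiplicity_decompose'[of "order G" "2::nat"] ord0 by auto
    then show ?thesis
      using that by blast
  qed
  obtain P where P: "subgroup P G" "card P = 2 ^ k"
    using sylow_thm[OF two_is_prime_nat is_group km(1) fin] by blast
  define A where "A = {x \<in> center G. x [^] m = \<one>}"
  have A: "subgroup A G"
  proof
    show "A \<subseteq> carrier G" "\<one> \<in> A"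
      using subgroup.one_closed[OF subgroup_center] by (auto simp: A_def)
  next
    fix x y assume "x \<in> A" "y \<in> A"
    then show "x \<otimes> y \<in> A"
      using subgroup.m_closed[OF subgroup_center]
      by (simp add: A_def center_commute pow_mult_distrib)
  next
    fix x assume "x \<in> A"
    then show "inv x \<in> A"
      using subgroup.m_inv_closed[OF subgroup_center] by (simp add: A_def nat_pow_inv)
  qed
  have PG: "P \<subseteq> carrier G" and AG: "A \<subseteq> carrier G"
    using P A by (auto dest: subgroup.subset)
  have A0: "card A \<noteq> 0"
    using finite_subset[OF AG fin] subgroup.one_closed[OF A] by auto
  have PA: "x = \<one>" if x: "x \<in> P" "x \<in> A" for x
  proof -
    have xG: "x \<in> carrier G"
      using x P by (auto dest: subgroup.mem_carrier)
    have "ord x dvd 2 ^ k" "ord x dvd m"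
      using subgroup_pow_card[OF P(1) x(1)] P(2) x xG by (auto simp: A_def simp flip: pow_eq_id)
    moreover have "coprime (2 ^ k) m"
      using km by simp
    ultimately have "ord x = 1"
      by (metis coprime_common_divisor_nat)
    then show ?thesis
      using xG ord_eq_1 by simp
  qed
  let ?f = "\<lambda>(x, y). x \<otimes> y"
  have inj: "inj_on ?f (P \<times> A)"
  proof (rule inj_onI, clarify)
    fix x y x' y' assume x: "x \<in> P" "x' \<in> P" and y: "y \<in> A" "y' \<in> A"
      and eq: "x \<otimes> y = x' \<otimes> y'"
    have c: "x \<in> carrier G" "x' \<in> carrier G" "y \<in> carrier G" "y' \<in> carrier G"
      using x y PG AG by auto
    have e: "inv x' \<otimes> x = y' \<otimes> inv y"
      using eq c by (metis inv_closed inv_solve_left inv_solve_right m_assoc m_closed)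
    moreover have "inv x' \<otimes> x \<in> P" "y' \<otimes> inv y \<in> A"
      using x y P A by (auto intro: subgroup.m_closed subgroup.m_inv_closed)
    ultimately have "inv x' \<otimes> x = \<one>" "y' \<otimes> inv y = \<one>"
      using PA by metis+
    then show "x = x' \<and> y = y'"
      using c by (metis inv_equality inv_inv inv_closed)
  qed
  have im: "?f ` (P \<times> A) \<subseteq> carrier G"
    using PG AG by auto
  \<comment> \<open>Injectivity of the product map bounds \<open>card A\<close> by \<open>m\<close>;
    divisibility by \<open>m\<close>, shown next, turns this into equality and makes the map
    onto.\<close>
  have "2 ^ k * card A \<le> 2 ^ k * m"
    using card_mono[OF fin im] card_image[OF inj] P km by (simp add: card_cartesian_product order_def)
  then have "card A \<le> m"
    by simp
  \<comment> \<open>Prime by prime: a subgroup \<open>K\<close> whose order is the full power of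
    \<open>q\<close> in \<open>m\<close> lies in \<open>A\<close>, so Lagrange gives that power in
    \<open>card A\<close>.\<close>
  moreover have "m dvd card A"
  proof (rule multiplicity_le_imp_dvd)
    show "m \<noteq> 0"
      using km by (cases m) auto
    fix q :: nat assume q: "prime q"
    define a where "a = multiplicity q m"
    have qa: "q ^ a dvd m"
      by (simp add: a_def multiplicity_dvd)
    then have "q ^ a dvd order G"
      using km by simp
    then obtain m' where "order G = q ^ a * m'" ..
    then obtain K where K: "subgroup K G" "card K = q ^ a"
      using sylow_thm[OF q is_group _ fin] by blast
    have "K \<subseteq> A"
    proof
      fix x assume x: "x \<in> K"
      then have xG: "x \<in> carrier G" and xq: "x [^] (q ^ a) = \<one>"
        using K subgroup_pow_card[OF K(1)] by (auto dest: subgroup.mem_carrier)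
      have "x [^] m = \<one>"
        using xq qa dvd_trans[of "ord x" "q ^ a" m] by (simp add: pow_eq_id xG)
      moreover have "x \<in> center G"
      \<comment> \<open>Since \<open>m\<close> is odd, \<open>q = 2\<close> occurs only with
        exponent 0, where \<open>K\<close> is trivial; for odd \<open>q\<close> the fact
        \<open>central\<close> applies.\<close>
      proof (cases "q = 2")
        case True
        then have "a = 0"
          using km by (simp add: a_def not_dvd_imp_multiplicity_0)
        then show ?thesis
          using xq xG subgroup.one_closed[OF subgroup_center] by simp
      next
        case False
        then have "odd q"
          using q primes_dvd_imp_eq two_is_prime_nat by blast
        then show ?thesis
          using central[OF q _ xG xq] by blast
      qed
      ultimately show "x \<in> A"
        by (simp add: A_def)
    qed
    then have "q ^ a dvd card A"
      using subgroup_card_dvd K A by metis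
    then show "multiplicity q m \<le> multiplicity q (card A)"
      using A0 not_prime_unit q unfolding a_def[symmetric] by (intro multiplicity_geI) auto
  qed
  ultimately have cardA: "card A = m"
    using A0 by (metis dvd_imp_le le_antisym not_gr_zero)
  have "?f ` (P \<times> A) = carrier G"
    using card_image[OF inj] P km cardA
    by (intro card_subset_eq fin im) (simp add: card_cartesian_product order_def)
  moreover have "?f \<in> hom (G\<lparr>carrier := P\<rparr> \<times>\<times> G\<lparr>carrier := A\<rparr>) G"
  proof (rule homI)
    fix u v assume "u \<in> carrier (G\<lparr>carrier := P\<rparr> \<times>\<times> G\<lparr>carrier := A\<rparr>)"
      "v \<in> carrier (G\<lparr>carrier := P\<rparr> \<times>\<times> G\<lparr>carrier := A\<rparr>)"
    then obtain x y x' y' where "u = (x, y)" "v = (x', y')" "x \<in> P" "x' \<in> P" "y \<in> A" "y' \<in> A"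
      by (auto simp: DirProd_def)
    moreover from this have "x' \<otimes> (y \<otimes> y') = y \<otimes> (x' \<otimes> y')"
      using PG by (intro center_lcomm) (auto simp: A_def)
    ultimately show "?f (u \<otimes>\<^bsub>G\<lparr>carrier := P\<rparr> \<times>\<times> G\<lparr>carrier := A\<rparr>\<^esub> v) = ?f u \<otimes> ?f v"
      using PG AG by (simp add: DirProd_def m_assoc subset_iff)
  qed (use im in \<open>auto simp: DirProd_def\<close>)
  ultimately have "?f \<in> iso (G\<lparr>carrier := P\<rparr> \<times>\<times> G\<lparr>carrier := A\<rparr>) G"
    using inj by (simp add: iso_def bij_betw_def DirProd_def)
  moreover have "comm_group (G\<lparr>carrier := A\<rparr>)"
    using subgroup_imp_group[OF A]
    by (rule group.group_comm_groupI) (simp add: A_def center_commute)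
  ultimately show ?thesis
    using P A km cardA by blast
qed

end
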